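(* For $n=4$ and for every integer $n\ge 6$, there exists a $3$-dimensional convex polytope $P\subset\mathbb{R}^3$ with exactly $n$ vertices such that $P=-P^\circ$.
   Context: For $A\subseteq\mathbb{R}^d$, the polar is $A^\circ=\{x\in\mathbb{R}^d:\langle x,a\rangle\le 1\text{ for all }a\in A\}$, and $-A=\{-a:a\in A\}$. *)

theory Defs
  imports "HOL-Analysis.Analysis"
begin

definition polar :: "'a::real_inner set \<Rightarrow> 'a set" where
  "polar A = {x. \<forall>a\<in>A. x \<bullet> a \<le> 1}"

end

theory Submission
  imports Defs
begin

text \<open>Start from the regular simplex and repeatedly modify a polytope \<open>P = - P\<degree>\<close> at a vertex \<open>v\<close>
  of degree 3: add a point \<open>p\<close> slightly beyond the triangular facet polar to \<open>v\<close>, and cut off \<open>v\<close>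
  by the plane polar to \<open>p\<close>. The result is again equal to minus its polar, and \<open>p\<close> is a vertex of
  degree 3. If \<open>p\<close> is generic, three vertices are gained; if \<open>p\<close> is chosen such that the cut
  passes through one neighbour of \<open>v\<close>, only two are. The vertex numbers \<open>4 + 2k\<close> and
  \<open>4 + 3 + 2k\<close> are exactly 4 and all integers from 6 on.\<close>

section \<open>Tools from linear algebra and convexity\<close>

text \<open>Pairing a vanishing combination of the \<open>a i\<close> with \<open>b k\<close>
  isolates its k-th coefficient, so the \<open>a i\<close> form a basis. The difference of the two
  sides is orthogonal to that basis, hence to itself.\<close>

lemma biorthogonal_expansion:
  fixes a b :: "'n::finite \<Rightarrow> real^'n"
  assumes orth: "\<And>i j. i \<noteq> j \<Longrightarrow> a i \<bullet> b j = 0" and diag: "\<And>i. a i \<bullet> b i \<noteq> 0"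
  shows "x = (\<Sum>i\<in>UNIV. ((a i \<bullet> x) / (a i \<bullet> b i)) *\<^sub>R b i)"
proof -
  have inj: "inj a"
    by (rule injI) (metis diag orth)
  have ind: "independent (range a)"
  proof
    assume "dependent (range a)"
    then obtain u y where y: "y \<in> range a" "u y \<noteq> 0" and s: "(\<Sum>z\<in>range a. u z *\<^sub>R z) = 0"
      by (auto simp: dependent_finite)
    then obtain k where k: "y = a k" by auto
    have "0 = (\<Sum>i\<in>UNIV. u (a i) *\<^sub>R a i) \<bullet> b k"
      using s by (simp add: sum.reindex[OF inj])
    also have "\<dots> = (\<Sum>i\<in>UNIV. if i = k then u (a k) * (a k \<bullet> b k) else 0)"
      unfolding inner_sum_left by (rule sum.cong) (use orth in auto)
    also have "\<dots> = u (a k) * (a k \<bullet> b k)" by simp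
    finally show False using y k diag by simp
  qed
  have "card (range a) = CARD('n)" using inj by (simp add: card_image)
  then have span: "span (range a) = UNIV"
    using independent_card_le_dim[of "range a" UNIV] ind dim_eq_full[of "range a"]
    by (simp add: dim_eq_card_independent)
  define y where "y = x - (\<Sum>i\<in>UNIV. ((a i \<bullet> x) / (a i \<bullet> b i)) *\<^sub>R b i)"
  have "orthogonal y z" if "z \<in> range a" for z :: "real^'n"
  proof -
    from that obtain k where k: "z = a k" by (rule rangeE)
    have "a k \<bullet> (\<Sum>i\<in>UNIV. ((a i \<bullet> x) / (a i \<bullet> b i)) *\<^sub>R b i)
        = (\<Sum>i\<in>UNIV. if i = k then a k \<bullet> x else 0)"
      unfolding inner_sum_right by (rule sum.cong) (use orth diag in auto)
    then show ?thesis by (simp add: y_def k orthogonal_def inner_diff_right inner_commute[of _ "a k"])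
  qed
  then have "orthogonal y y"
    using span by (metis UNIV_I orthogonal_to_span)
  then show ?thesis by (simp add: orthogonal_self y_def)
qed

text \<open>Here \<open>z\<close> is the apex of a simplex, \<open>e i\<close> are its base
  vertices, \<open>g i\<close> bounds the facet missing \<open>e i\<close>, and \<open>h\<close> the
  base. Expanding \<open>x - z\<close> in the edges \<open>e i - z\<close>, the bounds by
  \<open>g i\<close> make all coefficients nonnegative, and the bound by \<open>h\<close> makes
  their sum at most 1, with equality on the base.\<close>

lemma simplex_membership:
  fixes e g :: "'n::finite \<Rightarrow> real^'n"
  assumes go: "\<And>i. g i \<bullet> z = -1" and ge: "\<And>i j. i \<noteq> j \<Longrightarrow> g i \<bullet> e j = -1"
    and gd: "\<And>i. g i \<bullet> e i > -1" and he: "\<And>i. h \<bullet> e i = -1" and hz: "h \<bullet> z < -1"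
    and gx: "\<And>i. g i \<bullet> x \<ge> -1" and hx: "h \<bullet> x \<le> -1"
  shows "x \<in> convex hull (insert z (range e))"
    and "h \<bullet> x = -1 \<Longrightarrow> x \<in> convex hull (range e)"
proof -
  define l where "l i = (g i \<bullet> (x - z)) / (g i \<bullet> (e i - z))" for i
  have l0: "l i \<ge> 0" for i
    using gx[of i] go[of i] gd[of i] unfolding l_def
    by (auto simp: inner_diff_right intro!: divide_nonneg_pos)
  have rep: "x - z = (\<Sum>i\<in>UNIV. l i *\<^sub>R (e i - z))"
    unfolding l_def
  proof (rule biorthogonal_expansion)
    show "g i \<bullet> (e j - z) = 0" if "i \<noteq> j" for i j using ge[OF that] go by (simp add: inner_diff_right)
    show "g i \<bullet> (e i - z) \<noteq> 0" for i using gd[of i] go[of i] by (simp add: inner_diff_right)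
  qed
  have "h \<bullet> x - h \<bullet> z = h \<bullet> (\<Sum>i\<in>UNIV. l i *\<^sub>R (e i - z))"
    by (simp flip: rep add: inner_diff_right)
  also have "\<dots> = (\<Sum>i\<in>UNIV. l i) * (-1 - h \<bullet> z)"
    by (simp add: inner_sum_right inner_diff_right he sum_distrib_right)
  finally have s: "h \<bullet> x - h \<bullet> z = (\<Sum>i\<in>UNIV. l i) * (-1 - h \<bullet> z)" .
  have eq: "x = (1 - (\<Sum>i\<in>UNIV. l i)) *\<^sub>R z + (\<Sum>i\<in>UNIV. l i *\<^sub>R e i)"
    using rep by (simp add: scaleR_diff_right sum_subtractf scaleR_diff_left algebra_simps
        flip: scaleR_sum_left)
  have le: "(\<Sum>i\<in>UNIV. l i) \<le> 1"
  proof (rule ccontr)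
    assume "\<not> ?thesis"
    then have "1 * (-1 - h \<bullet> z) < (\<Sum>i\<in>UNIV. l i) * (-1 - h \<bullet> z)"
      using hz by (intro mult_strict_right_mono) auto
    then show False using s hx by simp
  qed
  show "x \<in> convex hull (range e)" if "h \<bullet> x = -1"
  proof -
    have "1 = (\<Sum>i\<in>UNIV. l i)" using s that hz by simp
    moreover have "(\<Sum>i\<in>UNIV. l i *\<^sub>R e i) \<in> convex hull (range e)"
      by (rule convex_sum) (use calculation l0 in \<open>auto intro: hull_inc\<close>)
    ultimately show ?thesis using eq by simp
  qed
  \<comment> \<open>Barycentric coordinates indexed by \<open>'n option\<close>, with the apex at
    \<open>None\<close>.\<close>
  define m where "m r = (case r of None \<Rightarrow> 1 - (\<Sum>i\<in>UNIV. l i) | Some i \<Rightarrow> l i)" for r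
  define pt where "pt r = (case r of None \<Rightarrow> z | Some i \<Rightarrow> e i)" for r
  have sp: "(\<Sum>r\<in>UNIV. F r) = F None + (\<Sum>i\<in>UNIV. F (Some i))"
    for F :: "'n option \<Rightarrow> 'b::comm_monoid_add"
    by (simp add: UNIV_option_conv sum.reindex)
  have "(\<Sum>r\<in>UNIV. m r *\<^sub>R pt r) \<in> convex hull (insert z (range e))"
    by (rule convex_sum)
      (use le l0 in \<open>auto intro: hull_inc simp: sp m_def pt_def split: option.splits\<close>)
  then show "x \<in> convex hull (insert z (range e))"
    using eq by (simp add: sp m_def pt_def)
qed

text \<open>Serves to choose perturbations that preserve finitely many strict inequalities.\<close>

lemma small_multiple_finite:
  fixes a b :: "'a \<Rightarrow> real"
  assumes "finite S" "\<And>x. x \<in> S \<Longrightarrow> a x > 0"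
  shows "\<forall>\<^sub>F \<delta> in at_right 0. \<forall>x\<in>S. \<delta> * b x < a x"
proof -
  have "\<forall>\<^sub>F \<delta> in at_right 0. \<delta> * b x < a x" if "x \<in> S" for x
  proof -
    have "((\<lambda>\<delta>. \<delta> * b x) \<longlongrightarrow> 0 * b x) (at_right 0)" by (intro tendsto_intros)
    then show ?thesis using assms(2)[OF that] by (intro order_tendstoD) auto
  qed
  then show ?thesis using assms(1) by (simp add: eventually_ball_finite)
qed

lemma hull_halfspace:
  fixes a :: "'a::real_inner"
  assumes "\<And>y. y \<in> S \<Longrightarrow> c \<le> a \<bullet> y" "x \<in> convex hull S"
  shows "c \<le> a \<bullet> x"
proof -
  have "convex hull S \<subseteq> {y. a \<bullet> y \<ge> c}"
    by (rule hull_minimal) (use assms(1) in \<open>auto simp: convex_halfspace_ge\<close>)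
  then show ?thesis using assms(2) by auto
qed

section \<open>Geometry of a corner: self-polarity, extreme points, edges at
  \<open>v\<close>\<close>

text \<open>\<open>V\<close> is the vertex set of a polytope equal to minus its polar, \<open>w i\<close> are the neighbours of
  the simplicial vertex \<open>v\<close>, and \<open>q i\<close> is polar to the facet through \<open>v\<close> that misses \<open>w i\<close>.\<close>

locale corner =
  fixes V :: "(real^'n::finite) set" and v :: "real^'n" and q w :: "'n \<Rightarrow> real^'n"
  assumes fin: "finite V"
    and pair: "\<And>x y. x \<in> V \<Longrightarrow> y \<in> V \<Longrightarrow> x \<bullet> y \<ge> -1"
    and cover: "\<And>x. (\<And>y. y \<in> V \<Longrightarrow> x \<bullet> y \<ge> -1) \<Longrightarrow> x \<in> convex hull V"
    and exposed: "\<And>u. u \<in> V \<Longrightarrow> \<exists>f. \<forall>x\<in>V-{u}. f \<bullet> u < f \<bullet> x"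
    and vV: "v \<in> V" and qV: "\<And>i. q i \<in> V" and wV: "\<And>i. w i \<in> V"
    and qv: "\<And>i. q i \<bullet> v = -1"
    and qw: "\<And>i j. i \<noteq> j \<Longrightarrow> q i \<bullet> w j = -1"
    and qwi: "\<And>i. q i \<bullet> w i > -1"
begin

lemma hull_pair:
  assumes "x \<in> convex hull V" "y \<in> convex hull V"
  shows "x \<bullet> y \<ge> -1"
proof (rule hull_halfspace[OF _ assms(2)])
  fix z assume "z \<in> V"
  then have "-1 \<le> z \<bullet> x" by (rule hull_halfspace[OF pair assms(1)])
  then show "-1 \<le> x \<bullet> z" by (simp add: inner_commute)
qed

text \<open>One inclusion is \<open>cover\<close>; the other is \<open>pair\<close>, extended from
  vertices to the hull in both arguments.\<close>

lemma hull_self_polar: "convex hull V = uminus ` polar (convex hull V)"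
proof -
  have "x \<in> uminus ` polar (convex hull V) \<longleftrightarrow> - x \<in> polar (convex hull V)" for x
    by (metis (no_types) image_iff minus_minus)
  moreover have "- x \<in> polar (convex hull V) \<longleftrightarrow> x \<in> convex hull V" for x
  proof
    assume "- x \<in> polar (convex hull V)"
    then have "x \<bullet> y \<ge> -1" if "y \<in> V" for y
      using hull_inc[OF that, of convex] by (force simp: polar_def)
    then show "x \<in> convex hull V" by (rule cover)
  next
    assume "x \<in> convex hull V"
    then show "- x \<in> polar (convex hull V)" using hull_pair[of x] by (force simp: polar_def)
  qed
  ultimately show ?thesis by blast
qed

text \<open>By \<open>exposed\<close>, an open halfspace contains all other points of
  \<open>V\<close> but not \<open>x\<close>, so \<open>V\<close> is convexly independent.\<close>

lemma extreme_points: "{x. x extreme_point_of convex hull V} = V"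
proof -
  have "x \<notin> convex hull (V - {x})" if x: "x \<in> V" for x
  proof
    assume *: "x \<in> convex hull (V - {x})"
    obtain f where f: "\<forall>y\<in>V-{x}. f \<bullet> x < f \<bullet> y" using exposed[OF x] by blast
    have "convex hull (V - {x}) \<subseteq> {y. f \<bullet> y > f \<bullet> x}"
      by (rule hull_minimal) (use f in \<open>auto simp: convex_halfspace_gt\<close>)
    then show False using * by auto
  qed
  then have "x extreme_point_of convex hull V" if "x \<in> V" for x
    using that extreme_point_of_convex_hull_convex_independent[of V x] fin
      finite_imp_compact by blast
  then show ?thesis using extreme_point_of_convex_hull by blast
qed

text \<open>If \<open>V\<close> has norm bound \<open>R\<close>, Cauchy-Schwarz shows that points of
  norm below \<open>1 / R\<close> pass the test in \<open>cover\<close>; so 0 is interior.\<close>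

lemma aff_dim_hull: "aff_dim (convex hull V) = int CARD('n)"
proof -
  obtain R where R: "R > 0" "\<And>x. x \<in> V \<Longrightarrow> norm x \<le> R"
    using finite_imp_bounded[OF fin] by (auto simp: bounded_pos)
  have "ball 0 (1 / R) \<subseteq> convex hull V"
  proof
    fix x :: "real^'n" assume x: "x \<in> ball 0 (1 / R)"
    show "x \<in> convex hull V"
    proof (rule cover)
      fix y assume "y \<in> V"
      then have "norm x * norm y \<le> 1 / R * R"
        using x R by (intro mult_mono) auto
      then show "x \<bullet> y \<ge> -1" using R(1) Cauchy_Schwarz_ineq2[of x y] by simp
    qed
  qed
  then have "0 \<in> interior (convex hull V)"
    by (meson R(1) centre_in_ball interiorI open_ball zero_less_divide_1_iff)
  then show ?thesis using aff_dim_nonempty_interior[of "convex hull V"] by auto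
qed

lemma q_inj: "inj q"
  by (rule injI) (metis less_irrefl qw qwi)

lemma v_ne_w: "w i \<noteq> v"
  using qv[of i] qwi[of i] by auto

lemma v_ne_q: "q i \<noteq> v"
proof
  assume "q i = v"
  then have "v \<bullet> v = -1" using qv[of i] by simp
  then show False using inner_ge_zero[of v] by linarith
qed

lemma expansion: "x - v = (\<Sum>i\<in>UNIV. ((q i \<bullet> (x - v)) / (q i \<bullet> (w i - v))) *\<^sub>R (w i - v))"
proof (rule biorthogonal_expansion)
  show "q i \<bullet> (w j - v) = 0" if "i \<noteq> j" for i j using qw[OF that] qv by (simp add: inner_diff_right)
  show "q i \<bullet> (w i - v) \<noteq> 0" for i using qwi[of i] qv[of i] by (simp add: inner_diff_right)
qed

lemma vertex_unique:
  assumes "\<And>i. q i \<bullet> x = -1"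
  shows "x = v"
  using expansion[of x] assms qv by (simp add: inner_diff_right)

lemma no_middle:
  assumes "x \<in> V" "y \<in> V" "z \<in> V" "x \<noteq> y" "x \<noteq> z" "0 \<le> t" "t \<le> 1"
  shows "x \<noteq> (1 - t) *\<^sub>R y + t *\<^sub>R z"
proof
  assume eq: "x = (1 - t) *\<^sub>R y + t *\<^sub>R z"
  obtain f where f: "\<forall>y\<in>V-{x}. f \<bullet> x < f \<bullet> y" using exposed[OF assms(1)] by blast
  have "f \<bullet> x < f \<bullet> y" "f \<bullet> x < f \<bullet> z" using f assms by auto
  then have "f \<bullet> x < (1 - t) * (f \<bullet> y) + t * (f \<bullet> z)"
    using convex_bound_lt[of "- (f \<bullet> y)" "- (f \<bullet> x)" "- (f \<bullet> z)" "1 - t" t] assms by simp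
  then show False using arg_cong[OF eq, of "\<lambda>x. f \<bullet> x"] by (simp add: inner_add_right)
qed

text \<open>By \<open>expansion\<close>, \<open>x\<close> lies on the ray from \<open>v\<close>
  through \<open>w k\<close>. Of three distinct vertices on a ray one would lie between the other
  two, which \<open>no_middle\<close> forbids.\<close>

lemma edge_unique:
  assumes x: "x \<in> V" and q: "\<And>i. i \<noteq> k \<Longrightarrow> q i \<bullet> x = -1"
  shows "x \<in> {v, w k}"
proof (rule ccontr)
  assume ne: "x \<notin> {v, w k}"
  define t where "t = (q k \<bullet> (x - v)) / (q k \<bullet> (w k - v))"
  have "x - v = (\<Sum>i\<in>UNIV. if i = k then t *\<^sub>R (w k - v) else 0)"
    by (subst expansion, rule sum.cong)
      (use q qv in \<open>auto simp: t_def inner_diff_right\<close>)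
  then have "x - v = t *\<^sub>R (w k - v)" by simp
  then have xt: "x = (1 - t) *\<^sub>R v + t *\<^sub>R w k"
    by (simp add: algebra_simps)
  have "t \<ge> 0" unfolding t_def
    using pair[OF qV[of k] x] qv[of k] qwi[of k]
    by (auto simp: inner_diff_right intro!: divide_nonneg_pos)
  then have "t > 1" using no_middle[OF x vV wV, of k t] ne xt by force
  then have "w k = (1 - 1 / t) *\<^sub>R v + (1 / t) *\<^sub>R x"
    by (simp add: xt scaleR_add_right scaleR_diff_right scaleR_diff_left)
  then show False
    using no_middle[OF wV vV x v_ne_w, where t = "1 / t"] \<open>t > 1\<close> ne by fastforce
qed

section \<open>The modification step and its vertex count\<close>

text \<open>The old vertex \<open>v\<close> is cut off by the plane polar to the new vertex \<open>p\<close>. The simplex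
  removed near \<open>v\<close> and the one added near \<open>p\<close> are polar to each other, so the result is again
  self-polar, and \<open>p\<close> is a simplicial vertex of it with the roles of \<open>q\<close> and \<open>w\<close> exchanged.\<close>

lemma add_and_cut:
  assumes pv: "p \<bullet> v < -1" and pV: "\<And>x. x \<in> V - {v} \<Longrightarrow> p \<bullet> x \<ge> -1"
    and pw: "\<And>x. x \<in> V - {v} \<Longrightarrow> p \<bullet> x = -1 \<Longrightarrow> x \<in> range w"
    and px: "\<And>u. u \<in> V - {v} \<Longrightarrow> \<exists>f. f \<bullet> u < f \<bullet> p \<and> (\<forall>x\<in>V-{u}. f \<bullet> u < f \<bullet> x)"
  shows "\<exists>V' y. corner V' p y q \<and> card V' = card V + card {i. p \<bullet> w i > -1}"
proof -
  \<comment> \<open>\<open>y i\<close> is the point where the edge from \<open>v\<close> to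
    \<open>w i\<close> meets the plane polar to \<open>p\<close>. The case \<open>t i = 1\<close>
    means that the plane passes through \<open>w i\<close>, and then \<open>y i\<close> is an old
    vertex.\<close>
  define t where "t i = (-1 - p \<bullet> v) / (p \<bullet> w i - p \<bullet> v)" for i
  define y where "y i = (1 - t i) *\<^sub>R v + t i *\<^sub>R w i" for i
  define V' where "V' = insert p (V - {v} \<union> range y)"
  have pwi: "p \<bullet> w i \<ge> -1" for i using pV[of "w i"] wV v_ne_w by auto
  have t0: "t i > 0" for i using pv pwi[of i] by (auto simp: t_def)
  have t1: "t i \<le> 1" for i using pv pwi[of i] by (auto simp: t_def)
  have t1_iff: "t i = 1 \<longleftrightarrow> p \<bullet> w i = -1" for i using pv pwi[of i] by (auto simp: t_def)
  have y_inner: "f \<bullet> y i = (1 - t i) * (f \<bullet> v) + t i * (f \<bullet> w i)" for f i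
    by (simp add: y_def inner_add_right)
  have yw: "y i = w i" if "t i = 1" for i using that by (simp add: y_def)
  have py: "p \<bullet> y i = -1" for i
  proof -
    have "p \<bullet> y i = p \<bullet> v + t i * (p \<bullet> w i - p \<bullet> v)" by (simp add: y_inner algebra_simps)
    then show ?thesis using pv pwi[of i] by (simp add: t_def)
  qed
  have qy: "q i \<bullet> y j = -1" if "i \<noteq> j" for i j
    by (simp add: y_inner qv qw[OF that])
  have qyi: "q i \<bullet> y i > -1" for i
  proof -
    have "q i \<bullet> y i = -1 + t i * (q i \<bullet> w i + 1)" by (simp add: y_inner qv algebra_simps)
    moreover have "t i * (q i \<bullet> w i + 1) > 0" using t0 qwi[of i] by simp
    ultimately show ?thesis by simp
  qed
  have y_inj: "inj y"
    by (rule injI) (metis less_irrefl qy qyi)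
  have yP: "y i \<in> convex hull V" for i
    unfolding y_def using t0[of i] t1[of i]
    by (intro convexD) (auto intro: hull_inc vV wV)
  have VP: "x \<in> convex hull V" if "x \<in> V" for x using that by (rule hull_inc)
  have V'P: "x \<in> convex hull V" if "x \<in> V'" "x \<noteq> p" for x
    using that yP VP by (auto simp: V'_def)
  have pp: "p \<bullet> p > -1" by (rule less_le_trans[of _ 0]) simp_all
  have pV': "p \<bullet> x \<ge> -1" if "x \<in> V'" for x
  proof (cases "x = p")
    case True
    then show ?thesis using pp by simp
  next
    case False
    then show ?thesis using that pV py by (auto simp: V'_def)
  qed
  have pP: "p \<notin> convex hull V" using hull_pair[OF _ VP[OF vV]] pv by force
  have y_notin: "y i \<notin> V" if "t i \<noteq> 1" for i
  proof
    assume "y i \<in> V"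
    have "y i - v = t i *\<^sub>R (w i - v)" "y i - w i = (1 - t i) *\<^sub>R (v - w i)"
      by (simp_all add: y_def algebra_simps)
    then have "y i \<noteq> v" "y i \<noteq> w i" using that t0[of i] v_ne_w[of i] by force+
    then show False
      using no_middle[OF \<open>y i \<in> V\<close> vV wV, of i "t i"] t0[of i] t1[of i] by (auto simp: y_def)
  qed
  have qV': "q i \<in> V'" for i using qV v_ne_q by (auto simp: V'_def)
  have "corner V' p y q"
  proof
    show "finite V'" using fin by (simp add: V'_def)
    show "x \<bullet> z \<ge> -1" if "x \<in> V'" "z \<in> V'" for x z
      using pV'[OF that(1)] pV'[OF that(2)] hull_pair[OF V'P V'P, OF that(1) _ that(2)]
      by (cases "x = p"; cases "z = p") (auto simp: inner_commute)
    show "p \<in> V'" "y i \<in> V'" "q i \<in> V'" for i using qV' by (auto simp: V'_def)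
    show "y i \<bullet> p = -1" for i using py by (simp add: inner_commute)
    show "y i \<bullet> q j = -1" if "i \<noteq> j" for i j using qy[of j i] that by (simp add: inner_commute)
    show "y i \<bullet> q i > -1" for i using qyi by (simp add: inner_commute)
    show "x \<in> convex hull V'" if x: "\<And>z. z \<in> V' \<Longrightarrow> x \<bullet> z \<ge> -1" for x
    \<comment> \<open>The case split is on the inequality given up with \<open>v\<close>. If
      \<open>x\<close> violates it, \<open>x\<close> lies in the added simplex with apex
      \<open>p\<close> and base vertices \<open>q i\<close>.\<close>
    proof (cases "v \<bullet> x \<ge> -1")
      case False
      have "x \<in> convex hull (insert p (range q))"
      proof (rule simplex_membership(1)[where g = y and h = v])
        show "v \<bullet> q i = -1" for i using qv by (simp add: inner_commute)
        show "v \<bullet> p < -1" using pv by (simp add: inner_commute)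
        show "y i \<bullet> x \<ge> -1" for i using x[of "y i"] by (simp add: V'_def inner_commute)
        show "y i \<bullet> p = -1" for i using py by (simp add: inner_commute)
        show "y i \<bullet> q j = -1" if "i \<noteq> j" for i j using qy[of j i] that by (simp add: inner_commute)
        show "y i \<bullet> q i > -1" for i using qyi by (simp add: inner_commute)
        show "v \<bullet> x \<le> -1" using False by simp
      qed
      moreover have "insert p (range q) \<subseteq> V'" using qV' by (auto simp: V'_def)
      ultimately show ?thesis using hull_mono by blast
    next
      case True
      have "x \<in> convex hull V"
      proof (rule cover)
        show "x \<bullet> z \<ge> -1" if "z \<in> V" for z
          using that x[of z] True by (cases "z = v") (auto simp: V'_def inner_commute)
      qed
      moreover have "V = insert v (V - {v})" using vV by auto
      moreover have "V - {v} \<noteq> {}" using wV v_ne_w by blast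
      \<comment> \<open>Otherwise \<open>x\<close> is on a segment from \<open>v\<close> to a point
        \<open>x'\<close> spanned by the remaining old vertices. This segment crosses the cutting
        plane at \<open>z\<close>, which lies in the hull of the \<open>y i\<close>; since
        \<open>x\<close> is not cut off, it is between \<open>z\<close> and
        \<open>x'\<close>.\<close>
      ultimately obtain s x' where s: "0 \<le> s" "s \<le> 1" and x': "x' \<in> convex hull (V - {v})"
        and xs: "x = (1 - s) *\<^sub>R v + s *\<^sub>R x'"
        using convex_hull_insert_alt[of v "V - {v}"] by auto
      have px': "p \<bullet> x' \<ge> -1" by (rule hull_halfspace[OF pV x'])
      have px: "p \<bullet> x \<ge> -1" using x[of p] by (simp add: V'_def inner_commute)
      have x'V': "x' \<in> convex hull V'" using x' hull_mono[of "V - {v}" V'] by (auto simp: V'_def)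
      define r where "r = (-1 - p \<bullet> v) / (p \<bullet> x' - p \<bullet> v)"
      have r: "0 < r" "r \<le> 1" using pv px' by (auto simp: r_def)
      define z where "z = (1 - r) *\<^sub>R v + r *\<^sub>R x'"
      have "p \<bullet> z = p \<bullet> v + r * (p \<bullet> x' - p \<bullet> v)" by (simp add: z_def inner_add_right algebra_simps)
      then have pz: "p \<bullet> z = -1" using pv px' by (simp add: r_def)
      have x'V: "x' \<in> convex hull V" using x' hull_mono[of "V - {v}" V] by auto
      have zP: "z \<in> convex hull V"
        unfolding z_def using r by (intro convexD) (auto intro: VP vV x'V)
      have zy: "z \<in> convex hull (range y)"
      proof (rule simplex_membership(2)[where g = q and h = p])
        show "q i \<bullet> z \<ge> -1" for i by (rule hull_pair[OF VP[OF qV] zP])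
      qed (use qv qy qyi py pv pz in auto)
      have zV': "z \<in> convex hull V'" using zy hull_mono[of "range y" V'] by (auto simp: V'_def)
      have sr: "r \<le> s"
      proof -
        have "p \<bullet> x = p \<bullet> v + s * (p \<bullet> x' - p \<bullet> v)" by (simp add: xs inner_add_right algebra_simps)
        then show ?thesis using px pv px' by (simp add: r_def pos_divide_le_eq)
      qed
      show ?thesis
      proof (cases "r = 1")
        case True
        then show ?thesis using sr s xs x'V' by simp
      next
        case False
        \<comment> \<open>\<open>m\<close> is the position of \<open>x\<close> on the segment from
          \<open>z\<close> to \<open>x'\<close>.\<close>
        define m where "m = (s - r) / (1 - r)"
        have m: "0 \<le> m" "m \<le> 1" using False r sr s by (auto simp: m_def divide_simps)
        have "(1 - m) * (1 - r) = 1 - s" using False by (simp add: m_def field_simps)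
        moreover from this have "(1 - m) * r + m = s" by (simp add: algebra_simps)
        ultimately have "x = (1 - m) *\<^sub>R z + m *\<^sub>R x'"
          by (simp add: xs z_def scaleR_add_right flip: scaleR_add_left)
        then show ?thesis using convexD[OF convex_convex_hull zV' x'V', of "1 - m" m] m by simp
      qed
    qed
    show "\<exists>f. \<forall>x\<in>V'-{u}. f \<bullet> u < f \<bullet> x" if u: "u \<in> V'" for u
    proof -
      consider "u = p" | "u \<in> V - {v}" | i where "u = y i" using u by (auto simp: V'_def)
      then show ?thesis
      proof cases
        case 1
        \<comment> \<open>The discarded vertex \<open>v\<close> exposes \<open>p\<close>: all other
          points of \<open>V'\<close> lie in the old hull.\<close>
        have "v \<bullet> u < v \<bullet> x" if "x \<in> V' - {u}" for x
          using hull_pair[OF VP[OF vV] V'P[of x]] that 1 pv by (auto simp: inner_commute)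
        then show ?thesis by blast
      next
        case 2
        then obtain f where f: "f \<bullet> u < f \<bullet> p" "\<And>x. x\<in>V-{u} \<Longrightarrow> f \<bullet> u < f \<bullet> x"
          using px by blast
        have "f \<bullet> u < f \<bullet> y i" if "y i \<noteq> u" for i
        proof (cases "t i = 1")
          case True
          then show ?thesis using f(2)[of "w i"] that wV yw by auto
        next
          case False
          \<comment> \<open>Only a weak inequality, as \<open>u\<close> may be \<open>w i\<close>;
            strictness comes from \<open>v\<close>, which has positive weight in
            \<open>y i\<close>.\<close>
          have "f \<bullet> u \<le> f \<bullet> w i" using f(2)[of "w i"] wV by force
          then have "t i * (f \<bullet> w i - f \<bullet> u) \<ge> 0" using t0[of i] by simp
          moreover have "(1 - t i) * (f \<bullet> v - f \<bullet> u) > 0"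
            using f(2)[of v] 2 vV False t1[of i] by auto
          ultimately show ?thesis unfolding y_inner by (simp add: algebra_simps)
        qed
        then show ?thesis using f by (intro exI[of _ f]) (auto simp: V'_def)
      next
        case (3 i)
        \<comment> \<open>On \<open>V'\<close>, \<open>p\<close> attains its minimum -1 exactly on
          \<open>range y\<close>. Subtracting a small multiple of \<open>q i\<close> breaks the tie
          in favour of \<open>y i\<close>, because \<open>q i\<close> is -1 at every other
          \<open>y j\<close>.\<close>
        define S where "S = {x \<in> V'. p \<bullet> x > -1}"
        have "finite S" using fin by (simp add: S_def V'_def)
        then have "\<forall>\<^sub>F \<delta> in at_right 0. \<forall>x\<in>S. \<delta> * (q i \<bullet> x - q i \<bullet> y i) < p \<bullet> x + 1"
          by (rule small_multiple_finite) (auto simp: S_def)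
        then obtain \<delta> where \<delta>: "\<delta> > 0" "\<And>x. x\<in>S \<Longrightarrow> \<delta> * (q i \<bullet> x - q i \<bullet> y i) < p \<bullet> x + 1"
          using eventually_happens'[OF trivial_limit_at_right_real
            eventually_conj[OF _ eventually_at_right_less]] by blast
        have "(p - \<delta> *\<^sub>R q i) \<bullet> y i < (p - \<delta> *\<^sub>R q i) \<bullet> x" if x: "x \<in> V' - {y i}" for x
        proof (cases "x \<in> S")
          case True
          then show ?thesis using \<delta>(2)[of x] py by (simp add: inner_diff_left algebra_simps)
        next
          case False
          then have px1: "p \<bullet> x = -1" using x pV'[of x] by (auto simp: S_def)
          then have "x \<noteq> p" using pp by auto
          have "x \<in> range y"
          proof (rule ccontr)
            assume "x \<notin> range y"
            then have "x \<in> V - {v}" using x \<open>x \<noteq> p\<close> by (auto simp: V'_def)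
            then obtain j where "x = w j" using pw px1 by blast
            then have "x = y j" using px1 t1_iff yw by metis
            then show False using \<open>x \<notin> range y\<close> by blast
          qed
          then obtain j where j: "x = y j" "j \<noteq> i" using x by auto
          have "\<delta> * (q i \<bullet> y i) > \<delta> * (-1)" using \<delta>(1) qyi by (intro mult_strict_left_mono)
          then show ?thesis using j py qy by (simp add: inner_diff_left)
        qed
        then show ?thesis using 3 by blast
      qed
    qed
  qed
  moreover have "card V' = card V + card {i. p \<bullet> w i > -1}"
  proof -
    \<comment> \<open>Outside \<open>I\<close>, \<open>y i\<close> is the old vertex
      \<open>w i\<close>. So \<open>v\<close> is lost, while \<open>p\<close> and one new vertex per
      element of \<open>I\<close> are gained.\<close>
    define I where "I = {i. p \<bullet> w i > -1}"
    have I: "i \<in> I \<longleftrightarrow> t i \<noteq> 1" for i using t1_iff[of i] pwi[of i] by (auto simp: I_def)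
    have "range y \<subseteq> V - {v} \<union> y ` I"
      using I yw wV v_ne_w by fastforce
    then have eq: "V' = insert p ((V - {v}) \<union> y ` I)" by (auto simp: V'_def)
    have "p \<notin> (V - {v}) \<union> y ` I" using pP yP VP by auto
    then have "card V' = Suc (card ((V - {v}) \<union> y ` I))"
      using fin unfolding eq by (intro card_insert_disjoint) auto
    also have "card ((V - {v}) \<union> y ` I) = card (V - {v}) + card (y ` I)"
      by (rule card_Un_disjoint) (use fin I y_notin in auto)
    also have "card (y ` I) = card I" by (intro card_image inj_on_subset[OF y_inj]) auto
    also have "card (V - {v}) = card V - 1" using vV fin by simp
    finally show ?thesis using vV fin card_gt_0_iff[of V] unfolding I_def by auto
  qed
  ultimately show ?thesis by blast
qed

section \<open>Choosing the new vertex\<close>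

text \<open>The new vertex is \<open>c + e d\<close> with \<open>c\<close> the centroid of the
  \<open>q i\<close> for \<open>i\<close> in \<open>I\<close> and \<open>e\<close> small. On
  \<open>V\<close>, \<open>c\<close> is at least -1, with equality only where all these
  \<open>q i\<close> are tight. There \<open>d\<close> pushes \<open>v\<close> below -1 and leaves
  the other points at -1; strict inequalities survive for small \<open>e\<close>.\<close>

lemma grow:
  fixes I :: "'n set"
  assumes I: "card I \<ge> 2" and dv: "d \<bullet> v < 0"
    and tight: "\<And>x. x \<in> V - {v} \<Longrightarrow> (\<forall>i\<in>I. q i \<bullet> x = -1) \<Longrightarrow> x \<in> range w \<and> d \<bullet> x = 0"
  shows "\<exists>V' v' q' w'. corner (V' :: (real^'n) set) v' q' w' \<and> card V' = card V + card I"
proof -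
  define c where "c = (1 / real (card I)) *\<^sub>R (\<Sum>i\<in>I. q i)"
  have I0: "finite I" "I \<noteq> {}" "real (card I) > 0" using I by (auto intro: card_ge_0_finite)
  have c_inner: "f \<bullet> c - b = (\<Sum>i\<in>I. f \<bullet> q i - b) / real (card I)" for f b
    using I0 by (simp add: c_def inner_sum_right sum_subtractf diff_divide_distrib)
  have c_pos: "f \<bullet> c > b"
    if "\<And>i. i \<in> I \<Longrightarrow> f \<bullet> q i \<ge> b" "k \<in> I" "f \<bullet> q k > b" for f b k
  proof -
    have "(\<Sum>i\<in>I. f \<bullet> q i - b) > 0"
      by (rule sum_pos2[OF I0(1) that(2)]) (use that in auto)
    then have "f \<bullet> c - b > 0" unfolding c_inner using I0(3) by (rule divide_pos_pos)
    then show ?thesis by simp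
  qed
  have c_eq: "c \<bullet> x = -1" if "\<And>i. i \<in> I \<Longrightarrow> q i \<bullet> x = -1" for x
  proof -
    have "x \<bullet> q i = -1" if "i \<in> I" for i
      using \<open>\<And>i. i \<in> I \<Longrightarrow> q i \<bullet> x = -1\<close>[OF that] by (simp add: inner_commute)
    then have "x \<bullet> c - (-1) = 0" unfolding c_inner by simp
    then show ?thesis by (simp add: inner_commute)
  qed
  have c_gt: "c \<bullet> x > -1" if "x \<in> V" "k \<in> I" "q k \<bullet> x \<noteq> -1" for x k
  proof -
    have ge: "x \<bullet> q i \<ge> -1" for i using pair[OF that(1) qV] .
    then have "x \<bullet> q k > -1" using that(3) ge[of k] by (simp add: inner_commute less_le)
    then have "x \<bullet> c > -1" using c_pos[of "-1" x, OF ge that(2)] by blast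
    then show ?thesis by (simp add: inner_commute)
  qed
  obtain f where f: "\<And>u x. u \<in> V \<Longrightarrow> x \<in> V - {u} \<Longrightarrow> f u \<bullet> u < f u \<bullet> x"
    using exposed by metis
  \<comment> \<open>This is where \<open>card I\<close> being at least 2 enters: some averaged
    \<open>q k\<close> differs from \<open>u\<close>, so the average is strictly above the minimum
    at \<open>u\<close>.\<close>
  have fc: "f u \<bullet> u < f u \<bullet> c" if u: "u \<in> V" for u
  proof -
    obtain k where k: "k \<in> I" "q k \<noteq> u"
    proof (rule ccontr)
      assume "\<not> thesis"
      then have "\<forall>k\<in>I. q k = u" using that by blast
      then have "q ` I \<subseteq> {u}" by blast
      moreover have "card (q ` I) = card I" by (intro card_image inj_on_subset[OF q_inj]) auto
      ultimately have "card I \<le> 1" using card_mono[of "{u}" "q ` I"] by simp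
      then show False using I by simp
    qed
    show ?thesis
    proof (rule c_pos[OF _ k(1)])
      show "f u \<bullet> q i \<ge> f u \<bullet> u" for i
        using f[OF u, of "q i"] qV by (cases "q i = u") (auto intro: less_imp_le)
      show "f u \<bullet> q k > f u \<bullet> u" using f[OF u] k qV by auto
    qed
  qed
  define S where "S = {x \<in> V - {v}. c \<bullet> x > -1}"
  have "\<forall>\<^sub>F e in at_right 0. \<forall>x\<in>S. e * (- (d \<bullet> x)) < c \<bullet> x + 1"
    by (rule small_multiple_finite) (use fin in \<open>auto simp: S_def\<close>)
  moreover have "\<forall>\<^sub>F e in at_right 0. \<forall>u\<in>V. e * (- (f u \<bullet> d)) < f u \<bullet> c - f u \<bullet> u"
    by (rule small_multiple_finite) (use fin fc in auto)
  ultimately obtain e where e: "e > 0" "\<And>x. x \<in> S \<Longrightarrow> e * (- (d \<bullet> x)) < c \<bullet> x + 1"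
      "\<And>u. u \<in> V \<Longrightarrow> e * (- (f u \<bullet> d)) < f u \<bullet> c - f u \<bullet> u"
    using eventually_happens'[OF trivial_limit_at_right_real
      eventually_conj[OF _ eventually_conj[OF _ eventually_at_right_less]]] by blast
  define p where "p = c + e *\<^sub>R d"
  have p_inner: "p \<bullet> x = c \<bullet> x + e * (d \<bullet> x)" for x by (simp add: p_def inner_add_left)
  have p_cases: "(\<forall>i\<in>I. q i \<bullet> x = -1) \<and> x \<in> range w \<and> p \<bullet> x = -1 \<or>
      (\<exists>i\<in>I. q i \<bullet> x \<noteq> -1) \<and> p \<bullet> x > -1" if x: "x \<in> V - {v}" for x
  proof (cases "\<forall>i\<in>I. q i \<bullet> x = -1")
    case True
    then show ?thesis using tight[OF x] c_eq[of x] by (simp add: p_inner)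
  next
    case False
    then have "x \<in> S" using c_gt x by (auto simp: S_def)
    then show ?thesis using e(2)[of x] False by (simp add: p_inner)
  qed
  have "\<exists>V' y. corner V' p y q \<and> card V' = card V + card {i. p \<bullet> w i > -1}"
  proof (rule add_and_cut)
    have "c \<bullet> v = -1" by (rule c_eq) (rule qv)
    then show "p \<bullet> v < -1" using dv e(1) by (simp add: p_inner mult_pos_neg)
    show "p \<bullet> x \<ge> -1" if "x \<in> V - {v}" for x using p_cases[OF that] by auto
    show "x \<in> range w" if "x \<in> V - {v}" "p \<bullet> x = -1" for x using p_cases[OF that(1)] that(2) by auto
    show "\<exists>f. f \<bullet> u < f \<bullet> p \<and> (\<forall>x\<in>V-{u}. f \<bullet> u < f \<bullet> x)" if "u \<in> V - {v}" for u
      using that e(3)[of u] f[of u] by (intro exI[of _ "f u"]) (auto simp: p_def inner_add_right)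
  qed
  then obtain V' y where V': "corner V' p y q" "card V' = card V + card {i. p \<bullet> w i > -1}"
    by blast
  \<comment> \<open>At \<open>w i\<close> the only \<open>q j\<close> that is not tight is
    \<open>q i\<close>, so \<open>w i\<close> stays off the cutting plane exactly when
    \<open>i\<close> is in \<open>I\<close>.\<close>
  have "{i. p \<bullet> w i > -1} = I"
  proof -
    have "p \<bullet> w i > -1 \<longleftrightarrow> (\<exists>j\<in>I. q j \<bullet> w i \<noteq> -1)" for i
      using p_cases[of "w i"] wV v_ne_w by auto
    moreover have "q j \<bullet> w i \<noteq> -1 \<longleftrightarrow> j = i" for i j
      using qw[of j i] qwi[of i] by auto
    ultimately show ?thesis by auto
  qed
  then have "card V' = card V + card I" using V'(2) by (rule subst)
  with V'(1) show ?thesis by blast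
qed

text \<open>With \<open>I = UNIV\<close> the condition \<open>tight\<close> is vacuous, since only
  \<open>v\<close> makes all \<open>q i\<close> tight; any direction decreasing \<open>v\<close>
  would do.\<close>

lemma grow_full:
  assumes "CARD('n) \<ge> 2"
  shows "\<exists>V' v' q' w'. corner (V' :: (real^'n) set) v' q' w' \<and> card V' = card V + CARD('n)"
proof (rule grow[where d = "- v"])
  have "v \<noteq> 0" using qv by auto
  then show "- v \<bullet> v < 0" by simp
  show "x \<in> range w \<and> - v \<bullet> x = 0" if "x \<in> V - {v}" "\<forall>i\<in>UNIV. q i \<bullet> x = -1" for x
    using vertex_unique[of x] that by auto
qed (rule assms)

text \<open>Here \<open>p\<close> is moved within the facet plane polar to a neighbour \<open>w k\<close> of \<open>v\<close>, so that the cut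
  passes through \<open>w k\<close> and creates one vertex less.\<close>

lemma grow_facet:
  assumes "CARD('n) \<ge> 3"
  shows "\<exists>V' v' q' w'. corner (V' :: (real^'n) set) v' q' w' \<and> card V' = card V + (CARD('n) - 1)"
proof -
  fix k :: 'n
  have card: "card (UNIV - {k}) = CARD('n) - 1" by (simp add: card_Diff_singleton)
  then have "card (UNIV - {k}) \<noteq> 0" using assms by linarith
  then obtain l where l: "l \<noteq> k" by (metis card.empty all_not_in_conv DiffD2 singletonI)
  \<comment> \<open>As \<open>q l\<close> is -1 at both \<open>w k\<close> and \<open>v\<close>, the
    coefficient makes \<open>d\<close> vanish at \<open>w k\<close> and leaves
    \<open>-1 - q k \<bullet> w k\<close>, which is negative, at \<open>v\<close>.\<close>
  define d where "d = q k + (q k \<bullet> w k) *\<^sub>R q l"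
  have "\<exists>V' v' q' w'. corner (V' :: (real^'n) set) v' q' w' \<and> card V' = card V + card (UNIV - {k})"
  proof (rule grow)
    show "card (UNIV - {k}) \<ge> 2" using assms card by simp
    show "d \<bullet> v < 0" using qwi[of k] by (simp add: d_def inner_add_left qv)
    show "x \<in> range w \<and> d \<bullet> x = 0" if x: "x \<in> V - {v}" "\<forall>i\<in>UNIV - {k}. q i \<bullet> x = -1" for x
    proof -
      have "x = w k" using edge_unique[of x k] x by auto
      then show ?thesis using qw[OF l] by (simp add: d_def inner_add_left)
    qed
  qed
  then show ?thesis unfolding card .
qed

end

section \<open>The starting simplex and the attainable vertex numbers\<close>

text \<open>Alternate vertices of the cube with coordinates 1 and -1 have pairwise inner product -1,
  so each is polar to the facet opposite to it. Hence \<open>q\<close> also serves as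
  \<open>w\<close>.\<close>

lemma corner_simplex:
  "\<exists>V v q w. corner (V :: (real^3) set) v q w \<and> card V = 4"
proof -
  define v :: "real^3" where "v = 1"
  define q :: "3 \<Rightarrow> real^3" where "q i = (\<chi> j. if j = i then 1 else -1)" for i
  define V where "V = insert v (range q)"
  have V: "V = {v, q 1, q 2, q 3}" by (auto simp: V_def UNIV_3)
  have vv: "v \<bullet> v = 3" by (simp add: v_def inner_vec_def)
  have qv: "q i \<bullet> v = -1" for i
    using exhaust_3[of i] by (auto simp: v_def q_def inner_vec_def sum_3)
  have qq: "q i \<bullet> q j = (if i = j then 3 else -1)" for i j
    using exhaust_3[of i] exhaust_3[of j] by (auto simp: q_def inner_vec_def sum_3)
  have vq: "v \<bullet> q i = -1" for i using qv by (simp add: inner_commute)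
  have VV: "x \<bullet> y = (if x = y then 3 else -1)" if "x \<in> V" "y \<in> V" for x y
    using that vv qv vq qq by (auto simp: V_def)
  have vn: "v \<noteq> q i" for i using vv qv[of i] by auto
  have qn: "q i \<noteq> q j" if "i \<noteq> j" for i j
  proof
    assume "q i = q j"
    then show False using qq[of i j] qq[of j j] that by simp
  qed
  have card: "card V = 4" using vn qn by (simp add: V)
  have sumV: "(\<Sum>u\<in>V. F u) = F v + F (q 1) + F (q 2) + F (q 3)"
    for F :: "real^3 \<Rightarrow> 'b::comm_monoid_add"
    using vn qn by (simp add: V add.assoc)
  have "corner V v q q"
  proof
    show "x \<in> convex hull V" if x: "\<And>y. y \<in> V \<Longrightarrow> x \<bullet> y \<ge> -1" for x
    proof -
      \<comment> \<open>These are barycentric coordinates: the four vertices sum to 0, and the sum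
        of \<open>(x \<bullet> u) u\<close> over them is \<open>4 x\<close>.\<close>
      define l where "l u = (x \<bullet> u + 1) / 4" for u
      have "(\<Sum>u\<in>V. l u *\<^sub>R u) \<in> convex hull V"
      proof (rule convex_sum)
        show "(\<Sum>u\<in>V. l u) = 1"
          by (simp add: sumV l_def v_def q_def inner_vec_def sum_3 field_simps)
        show "0 \<le> l u" if "u \<in> V" for u using x[OF that] by (simp add: l_def)
      qed (auto simp: V intro: hull_inc)
      moreover have "(\<Sum>u\<in>V. l u *\<^sub>R u) = x"
        by (simp add: sumV l_def v_def q_def inner_vec_def sum_3 vec_eq_iff forall_3 field_simps)
      ultimately show ?thesis by simp
    qed
    show "\<exists>f. \<forall>x\<in>V-{u}. f \<bullet> u < f \<bullet> x" if "u \<in> V" for u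
      by (rule exI[of _ "- u"]) (use VV that in auto)
  qed (use VV qv qq in \<open>auto simp: V_def\<close>)
  then show ?thesis using card by blast
qed

lemma corner_add_even:
  assumes "card V0 = m" "corner (V0 :: (real^3) set) v0 q0 w0"
  shows "\<exists>V v q w. corner (V :: (real^3) set) v q w \<and> card V = m + 2 * k"
proof (induction k)
  case 0
  then show ?case using assms by auto
next
  case (Suc k)
  then obtain V v q w where "corner (V :: (real^3) set) v q w" "card V = m + 2 * k" by blast
  then show ?case using corner.grow_facet[of V v q w] by simp
qed

theorem theorem4p7:
  fixes n :: nat
  assumes "n = 4 \<or> n \<ge> 6"
  shows "\<exists>P :: (real^3) set. polytope P \<and> aff_dim P = 3 \<and>
           card {v. v extreme_point_of P} = n \<and> P = uminus ` polar P"
proof -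
  obtain V0 v0 q0 w0 where base: "corner (V0 :: (real^3) set) v0 q0 w0" "card V0 = 4"
    using corner_simplex by blast
  obtain V1 v1 q1 w1 where base1: "corner (V1 :: (real^3) set) v1 q1 w1" "card V1 = 7"
    using corner.grow_full[OF base(1)] base(2) by auto
  have "(\<exists>k. n = 4 + 2 * k) \<or> (\<exists>k. n = 7 + 2 * k)"
    using assms by presburger
  then obtain V v q w where V: "corner (V :: (real^3) set) v q w" "card V = n"
    using corner_add_even[OF base(2,1)] corner_add_even[OF base1(2,1)] by metis
  interpret corner V v q w by (rule V(1))
  show ?thesis
    using hull_self_polar aff_dim_hull extreme_points V(2) polytope_convex_hull[OF fin]
    by (intro exI[of _ "convex hull V"]) auto
qed

end
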